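(* Let $f=S_{1,3}$. For every integer $n\ge 1$, the sequence $(f^k(n))_{k\ge 1}$ eventually enters the cycle $\{2,3\}$ (i.e. $(2,10_3)$, with $f(2)=3$, $f(3)=2$) if and only if at least one of the numbers $n$ and $2^{\#1(n)_3}$ has no digit $1$ in its ternary expansion; otherwise it eventually reaches the fixed point $4=11_3$.
   Context: For integers $t\ge 0$, $b\ge 2$, the $t$-shifted Sloane map in base $b$ is $S_{t,b}(n)=\prod_{i=0}^k (d_i+t)$, where $n=\sum_{i=0}^k d_ib^i$ is the base-$b$ expansion of $n$ ($0\le d_i\le b-1$, $d_k>0$). Thus $S_{1,3}(n)=2^{\#0(n)_3}3^{\#1(n)_3}\cdot$ … more precisely each ternary digit $d$ contributes a factor $d+1$. $\#1(n)_3$ denotes the number of digits equal to $1$ in the base-$3$ expansion of $n$. $f^k$ denotes the $k$-th iterate. *)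

theory Defs
  imports Main
begin

text \<open>Digits of \<open>n\<close> in base \<open>b \<ge> 2\<close>, least significant first. The number 0 has the single digit 0.
  For \<open>b < 2\<close> the value is irrelevant; the guard only ensures termination.\<close>

fun base_digits :: "nat \<Rightarrow> nat \<Rightarrow> nat list" where
  "base_digits b n = (if n < b \<or> b < 2 then [n] else n mod b # base_digits b (n div b))"

declare base_digits.simps [simp del]

text \<open>The next three facts, with uniqueness of the expansion, confirm that this is the base-\<open>b\<close>
  expansion \<open>n = (\<Sum>i\<le>k. d i * b ^ i)\<close> with \<open>0 \<le> d i \<le> b - 1\<close> and \<open>d k > 0\<close>.\<close>

lemma base_digits_sum:
  assumes "b \<ge> 2"
  shows "n = (\<Sum>i<length (base_digits b n). base_digits b n ! i * b ^ i)"
  using assms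
proof (induction b n rule: base_digits.induct)
  case (1 b n)
  show ?case
  proof (cases "n < b")
    case True
    then show ?thesis by (simp add: base_digits.simps[of b n])
  next
    case False
    define ds where "ds = base_digits b (n div b)"
    have IH: "n div b = (\<Sum>i<length ds. ds ! i * b ^ i)"
      using 1 False unfolding ds_def by simp
    have "base_digits b n = n mod b # ds"
      using False 1 by (simp add: base_digits.simps[of b n] ds_def)
    then have "(\<Sum>i<length (base_digits b n). base_digits b n ! i * b ^ i)
        = n mod b + (\<Sum>i<length ds. ds ! i * b ^ Suc i)"
      by (simp only: length_Cons sum.lessThan_Suc_shift) simp
    also have "(\<Sum>i<length ds. ds ! i * b ^ Suc i) = b * (n div b)"
      unfolding IH sum_distrib_left by (intro sum.cong) auto
    finally show ?thesis by simp
  qed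
qed

lemma base_digits_less: "b \<ge> 2 \<Longrightarrow> d \<in> set (base_digits b n) \<Longrightarrow> d < b"
proof (induction b n rule: base_digits.induct)
  case (1 b n)
  then show ?case
    by (auto simp: base_digits.simps[of b n] split: if_splits)
qed

lemma base_digits_last: "b \<ge> 2 \<Longrightarrow> n \<ge> 1 \<Longrightarrow> last (base_digits b n) > 0"
proof (induction b n rule: base_digits.induct)
  case (1 b n)
  have "base_digits b (n div b) \<noteq> []"
    by (subst base_digits.simps) simp
  with 1 show ?case
    by (cases "n < b") (simp_all add: base_digits.simps[of b n] div_greater_zero_iff Suc_le_eq)
qed

definition sloane :: "nat \<Rightarrow> nat \<Rightarrow> nat \<Rightarrow> nat" where
  "sloane t b n = (\<Prod>d\<leftarrow>base_digits b n. d + t)"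

definition num_digit :: "nat \<Rightarrow> nat \<Rightarrow> nat \<Rightarrow> nat" where
  "num_digit b d n = count_list (base_digits b n) d"

end

theory Submission
  imports Defs
begin

text \<open>Since \<open>f n = 2 ^ a * 3 ^ c\<close>, where \<open>a\<close> and \<open>c\<close> count the digits 1 and 2 of \<open>n\<close>, and since
  trailing zeros do not affect \<open>f\<close>, the orbit is governed by the map \<open>g\<close> sending \<open>a\<close> to the number
  of digits 1 of \<open>2 ^ a\<close>. A number has the parity of its number of ternary digits 1, so \<open>g a\<close> is even
  for \<open>a \<ge> 1\<close>; and for even \<open>a\<close> the last digit of \<open>2 ^ a\<close> is 1, so \<open>g a \<ge> 2\<close>. Moreover
  \<open>2 ^ a < 3 ^ (a - 1)\<close> gives \<open>g a < a\<close> for \<open>a \<ge> 3\<close>. Hence from a positive even exponent \<open>g\<close> descends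
  to 2, that is, \<open>f\<close> reaches 4. If \<open>a = 0\<close> or \<open>g a = 0\<close>, the orbit meets a power of 3 instead, which
  \<open>f\<close> sends to 2.\<close>

declare One_nat_def [simp del]

lemma num_digit_less: "n < b \<Longrightarrow> num_digit b d n = of_bool (n = d)"
  by (simp add: num_digit_def base_digits.simps[of b n])

lemma num_digit_ge:
  "2 \<le> b \<Longrightarrow> b \<le> n \<Longrightarrow> num_digit b d n = of_bool (n mod b = d) + num_digit b d (n div b)"
  by (simp add: num_digit_def base_digits.simps[of b n])

lemma sloane_less: "n < b \<Longrightarrow> sloane t b n = n + t"
  by (simp add: sloane_def base_digits.simps[of b n])

lemma sloane_ge: "2 \<le> b \<Longrightarrow> b \<le> n \<Longrightarrow> sloane t b n = (n mod b + t) * sloane t b (n div b)"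
  by (simp add: sloane_def base_digits.simps[of b n])

text \<open>A number below \<open>b ^ k\<close> has at most \<open>k\<close> digits in all. The case
  \<open>k = 0\<close> is excluded because 0 still has one digit.\<close>

lemma num_digit_le:
  assumes "2 \<le> b" "1 \<le> k" "n < b ^ k"
  shows "num_digit b d n \<le> k"
  using assms(2,3)
proof (induction k arbitrary: n rule: nat_induct_at_least)
  case base
  then show ?case by (simp add: num_digit_less)
next
  case (Suc k)
  show ?case
  proof (cases "n < b")
    case True
    then show ?thesis by (simp add: num_digit_less)
  next
    case False
    have "n div b < b ^ k"
      using Suc.prems by (simp add: less_mult_imp_div_less mult.commute)
    then show ?thesis
      using Suc.IH[of "n div b"] False assms(1) by (simp add: num_digit_ge)
  qed
qed

lemma sloane_1_3_eq: "sloane 1 3 n = 2 ^ num_digit 3 1 n * 3 ^ num_digit 3 2 n"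
proof (induction n rule: less_induct)
  case (less n)
  show ?case
  proof (cases "n < 3")
    case True
    then have "n = 0 \<or> n = 1 \<or> n = 2" by linarith
    then show ?thesis by (auto simp: sloane_less num_digit_less)
  next
    case False
    define m d where "m = n div 3" and "d = n mod 3"
    have "sloane 1 3 n = (d + 1) * (2 ^ num_digit 3 1 m * 3 ^ num_digit 3 2 m)"
      using False less[of m] by (simp add: sloane_ge m_def d_def)
    moreover have "num_digit 3 k n = of_bool (d = k) + num_digit 3 k m" for k
      using False by (simp add: num_digit_ge m_def d_def)
    moreover have "d < 3" by (simp add: d_def)
    then have "d = 0 \<or> d = 1 \<or> d = 2" by linarith
    ultimately show ?thesis by (auto simp: power_add)
  qed
qed

text \<open>As 3 is odd, \<open>n\<close> is congruent modulo 2 to its digit sum, and among the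
  digits 0, 1, 2 only 1 is odd.\<close>

lemma even_num_digit_3_1: "even (num_digit 3 1 n) \<longleftrightarrow> even n"
proof (induction n rule: less_induct)
  case (less n)
  show ?case
  proof (cases "n < 3")
    case True
    then have "n = 0 \<or> n = 1 \<or> n = 2" by linarith
    then show ?thesis by (auto simp: num_digit_less)
  next
    case False
    then have IH: "even (num_digit 3 1 (n div 3)) \<longleftrightarrow> even (n div 3)"
      using less[of "n div 3"] by simp
    have "even n \<longleftrightarrow> (n mod 3 = 1) \<noteq> even (n div 3)"
      by presburger
    then show ?thesis
      using False IH by (simp add: num_digit_ge)
  qed
qed

lemma num_digit_mod_pos:
  assumes "2 \<le> b"
  shows "num_digit b (n mod b) n > 0"
  using assms by (cases "n < b") (simp_all add: num_digit_less num_digit_ge)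

text \<open>With shift 1, each appended digit 0 contributes the factor 0 + 1 = 1.\<close>

lemma sloane_1_mult_power:
  assumes "2 \<le> b" "1 \<le> m"
  shows "sloane 1 b (m * b ^ c) = sloane 1 b m"
proof (induction c)
  case (Suc c)
  have "m * b ^ c > 0" using assms by simp
  then have "b \<le> b * (m * b ^ c)" by simp
  then have "sloane 1 b (b * (m * b ^ c)) = sloane 1 b (m * b ^ c)"
    using assms sloane_ge[of b "b * (m * b ^ c)" 1] by simp
  with Suc show ?case by (simp add: mult.left_commute)
qed simp

lemma power_2_less_power_3: "3 \<le> a \<Longrightarrow> 2 ^ a < (3::nat) ^ (a - 1)"
proof (induction a rule: nat_induct_at_least)
  case (Suc a)
  then show ?case by (cases a) simp_all
qed simp

lemma num_digit_power_2:
  assumes "even a" "2 \<le> a"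
  shows "even (num_digit 3 1 (2 ^ a))" "2 \<le> num_digit 3 1 (2 ^ a)"
proof -
  show ev: "even (num_digit 3 1 (2 ^ a))"
    using assms by (simp add: even_num_digit_3_1)
  \<comment> \<open>With \<open>a = 2 * j\<close>, \<open>2 ^ a = 4 ^ j\<close> is 1 modulo 3, so a
    digit 1 occurs; evenness of the count then forces at least two.\<close>
  obtain j where "a = 2 * j" using assms(1) by blast
  then have "(2::nat) ^ a mod 3 = 4 ^ j mod 3" by (simp add: power_mult)
  also have "\<dots> = 1" using power_mod[of "4::nat" 3 j] by simp
  finally have "num_digit 3 1 (2 ^ a) > 0"
    using num_digit_mod_pos[of 3 "2 ^ a"] by simp
  with ev show "2 \<le> num_digit 3 1 (2 ^ a)" by presburger
qed

lemma sloane_values: "sloane 1 3 1 = 2" "sloane 1 3 2 = 3" "sloane 1 3 3 = 2" "sloane 1 3 4 = 4"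
  by (simp_all add: sloane_less sloane_ge)

text \<open>Strong induction on \<open>a\<close>, with \<open>c\<close> arbitrary because the next
  iterate brings its own power of 3.\<close>

lemma sloane_reaches_4:
  assumes "even a" "2 \<le> a"
  shows "\<exists>K. (sloane 1 3 ^^ K) (2 ^ a * 3 ^ c) = 4"
  using assms
proof (induction a arbitrary: c rule: less_induct)
  case (less a)
  have step: "sloane 1 3 (2 ^ a * 3 ^ c) = sloane 1 3 (2 ^ a)"
    by (simp add: sloane_1_mult_power)
  show ?case
  proof (cases "a = 2")
    case True
    then have "(sloane 1 3 ^^ Suc 0) (2 ^ a * 3 ^ c) = 4"
      using step sloane_values(4) by simp
    then show ?thesis by blast
  next
    case False
    with less.prems have "3 \<le> a" by simp
    then have "num_digit 3 1 (2 ^ a) \<le> a - 1"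
      by (intro num_digit_le power_2_less_power_3) simp_all
    with \<open>3 \<le> a\<close> have "num_digit 3 1 (2 ^ a) < a" by linarith
    then obtain K where "(sloane 1 3 ^^ K) (sloane 1 3 (2 ^ a)) = 4"
      using less.IH num_digit_power_2[OF less.prems] sloane_1_3_eq[of "2 ^ a"] by metis
    then have "(sloane 1 3 ^^ Suc K) (2 ^ a * 3 ^ c) = 4"
      by (simp add: funpow_swap1 step)
    then show ?thesis by blast
  qed
qed

lemma funpow_invariant:
  assumes "\<And>x. x \<in> S \<Longrightarrow> f x \<in> S" "(f ^^ K) n \<in> S" "K \<le> k"
  shows "(f ^^ k) n \<in> S"
  using assms(3) by (induction k rule: dec_induct) (simp_all add: assms)

lemma eventually_in_invariant_set:
  assumes "\<And>x. x \<in> S \<Longrightarrow> f x \<in> S" "(f ^^ K) n \<in> S"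
  shows "\<exists>K\<ge>1. \<forall>k\<ge>K. (f ^^ k) n \<in> S"
proof (intro exI conjI allI impI)
  \<comment> \<open>The orbit may start inside \<open>S\<close>, with \<open>K = 0\<close>;
    \<open>Suc K\<close> secures a positive bound.\<close>
  show "1 \<le> Suc K" by simp
  show "(f ^^ k) n \<in> S" if "Suc K \<le> k" for k
    using funpow_invariant[of S f K n k] assms that by simp
qed

text \<open>The first step leaves a power of 2 times a power of 3, and the second ignores the latter
  as trailing zeros.\<close>

lemma sloane_funpow_2: "(sloane 1 3 ^^ 2) n = sloane 1 3 (2 ^ num_digit 3 1 n)"
  by (simp add: numeral_2_eq_2 sloane_1_3_eq[of n] sloane_1_mult_power)

lemma sloane_eventually_2_3:
  assumes "num_digit 3 1 n = 0 \<or> num_digit 3 1 (2 ^ num_digit 3 1 n) = 0"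
  shows "\<exists>K\<ge>1. \<forall>k\<ge>K. (sloane 1 3 ^^ k) n \<in> {2, 3}"
proof -
  have "\<exists>K. (sloane 1 3 ^^ K) n = 2"
  proof (cases "num_digit 3 1 n = 0")
    case True
    then have "(sloane 1 3 ^^ 2) n = 2"
      using sloane_values(1) by (simp add: sloane_funpow_2)
    then show ?thesis by blast
  next
    case False
    define c where "c = num_digit 3 2 (2 ^ num_digit 3 1 n)"
    \<comment> \<open>No digit 1 means no factor 2; the remaining \<open>3 ^ c\<close> is a 1
      followed by zeros, so one more step gives 2.\<close>
    have "(sloane 1 3 ^^ 2) n = 3 ^ c"
      using False assms sloane_1_3_eq[of "2 ^ num_digit 3 1 n"] by (simp add: sloane_funpow_2 c_def)
    moreover have "sloane 1 3 (3 ^ c) = 2"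
      using sloane_1_mult_power[of 3 1 c] sloane_values(1) by simp
    ultimately have "(sloane 1 3 ^^ Suc 2) n = 2"
      by (metis funpow.simps(2) comp_apply)
    then show ?thesis by blast
  qed
  then show ?thesis
    using eventually_in_invariant_set[of "{2, 3}" "sloane 1 3"] sloane_values by fastforce
qed

lemma sloane_eventually_4:
  assumes "num_digit 3 1 n \<noteq> 0" "num_digit 3 1 (2 ^ num_digit 3 1 n) \<noteq> 0"
  shows "\<exists>K\<ge>1. \<forall>k\<ge>K. (sloane 1 3 ^^ k) n = 4"
proof -
  let ?g = "num_digit 3 1 (2 ^ num_digit 3 1 n)"
  \<comment> \<open>The exponent of 2 in the second iterate is \<open>?g\<close>; a positive first
    exponent makes it even, as the descent to 4 requires.\<close>
  have "even ?g"
    using assms(1) by (simp add: even_num_digit_3_1)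
  moreover from this have "2 \<le> ?g"
    using assms(2) by presburger
  ultimately obtain K where "(sloane 1 3 ^^ K) ((sloane 1 3 ^^ 2) n) = 4"
    using sloane_reaches_4 sloane_1_3_eq[of "2 ^ num_digit 3 1 n"] sloane_funpow_2 by metis
  then have "(sloane 1 3 ^^ (K + 2)) n = 4"
    by (simp only: funpow_add comp_apply)
  then show ?thesis
    using eventually_in_invariant_set[of "{4}" "sloane 1 3"] sloane_values(4) by fastforce
qed

theorem theorem8:
  fixes f :: "nat \<Rightarrow> nat"
  defines "f \<equiv> sloane 1 3"
  shows "f 2 = 3 \<and> f 3 = 2 \<and> f 4 = 4 \<and>
    (\<forall>n\<ge>1.
      ((\<exists>K\<ge>1. \<forall>k\<ge>K. (f ^^ k) n \<in> {2, 3}) \<longleftrightarrow>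
         num_digit 3 1 n = 0 \<or> num_digit 3 1 (2 ^ num_digit 3 1 n) = 0) \<and>
      (\<not> (num_digit 3 1 n = 0 \<or> num_digit 3 1 (2 ^ num_digit 3 1 n) = 0) \<longrightarrow>
         (\<exists>K\<ge>1. \<forall>k\<ge>K. (f ^^ k) n = 4)))"
proof -
  \<comment> \<open>This yields the only-if direction: at time \<open>max K L\<close> the two
    limiting behaviours would contradict each other.\<close>
  have excl: False if "\<forall>k\<ge>K. (f ^^ k) n \<in> {2, 3}" "\<forall>k\<ge>L. (f ^^ k) n = 4" for n K L
    using that(1)[rule_format, of "max K L"] that(2)[rule_format, of "max K L"] by simp
  show ?thesis
    using sloane_values sloane_eventually_2_3 sloane_eventually_4 excl unfolding f_def by meson
qed

end
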